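(* Let $F=\frac1n\sum_{i=1}^nF_i$ where each $F_i:\mathbb{R}^d\to\mathbb{R}^d$ is $L$-Lipschitz and $\mu$-strongly monotone ($\mu>0$), and let $x_*$ satisfy $F(x_* )=0$. Let $\{x_k\}$ be generated by DecPolyakSEG with $\gamma_k$ satisfying, for all $k\ge 0$, the stochastic critical condition $$\|F_{\mathcal S_k}(\hat x_k)-F_{\mathcal S_k}(x_k)\|\le A\|F_{\mathcal S_k}(x_k)\|$$ with a fixed $A\in(0,1)$. Then, almost surely, $$\sup_{k\ge 0}\|x_k-x_*\|^2\le\max\left\{\|x_0-x_*\|^2,\ \frac{1}{\mu^2(1-A)}\max_{1\le i\le n}\|F_i(x_* )\|^2\right\}<\infty.$$ Consequently, the extrapolated points $\hat x_k$ also stay bounded almost surely.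
   Context: $\langle\cdot,\cdot\rangle$ and $\|\cdot\|$ are Euclidean; $[n]=\{1,\dots,n\}$. $G$ is $L$-Lipschitz if $\|G(x)-G(y)\|\le L\|x-y\|$ for all $x,y$, and $\mu$-strongly monotone if $\langle G(x)-G(y),x-y\rangle\ge\mu\|x-y\|^2$ for all $x,y$. For a mini-batch $\mathcal S$ of indices from $[n]$ (possibly with repetition), $F_{\mathcal S}=\frac1{|\mathcal S|}\sum_{i\in\mathcal S}F_i$. At each iteration $k$ a mini-batch $\mathcal S_k$ is drawn at random from $[n]$ uniformly with replacement, independently of the past. DecPolyakSEG: given $x_0\in\mathbb{R}^d$, a non-decreasing positive sequence $\{c_k\}_{k\ge -1}$, $\gamma_{-1}>0$, and $\gamma_k$ with $0<\gamma_k\le\frac{c_{k-1}}{c_k}\gamma_{k-1}$ for $k\ge 0$, set $\alpha_{-1}=\infty$ and for $k=0,1,\dots$: sample $\mathcal S_k$ and set $$\hat x_k=x_k-\gamma_kF_{\mathcal S_k}(x_k),\quad\alpha_k=\min\left\{\frac{\langle F_{\mathcal S_k}(\hat x_k),x_k-\hat x_k\rangle}{\|F_{\mathcal S_k}(\hat x_k)\|^2},\alpha_{k-1}\right\},\quad x_{k+1}=x_k-\alpha_kF_{\mathcal S_k}(\hat x_k).$$ Convention: if $F_{\mathcal S_k}(\hat x_k)=0$, set $\alpha_k=\min\{\alpha_{k-1},\gamma_k\}$, so that $x_{k+1}=x_k$. *)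

theory Defs
  imports "HOL-Probability.Probability"
begin

definition strongly_monotone :: "real \<Rightarrow> ('a::real_inner \<Rightarrow> 'a) \<Rightarrow> bool" where
  "strongly_monotone \<mu> G \<longleftrightarrow>
     (\<forall>x y. inner (G x - G y) (x - y) \<ge> \<mu> * (norm (x - y))\<^sup>2)"

definition full_operator :: "nat \<Rightarrow> (nat \<Rightarrow> 'a::real_vector \<Rightarrow> 'a) \<Rightarrow> 'a \<Rightarrow> 'a" where
  "full_operator n F x = (1 / real n) *\<^sub>R (\<Sum>i=1..n. F i x)"

text \<open>A mini-batch is a list of indices, so that an index may occur several times.\<close>

definition batch_operator :: "(nat \<Rightarrow> 'a::real_vector \<Rightarrow> 'a) \<Rightarrow> nat list \<Rightarrow> 'a \<Rightarrow> 'a" where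
  "batch_operator F S x = (1 / real (length S)) *\<^sub>R (\<Sum>i\<leftarrow>S. F i x)"

text \<open>
  The \<open>k\<close>-th batch consists of \<open>b k\<close> indices drawn uniformly with replacement from
  \<open>{1..n}\<close>. The step sizes \<open>\<gamma>\<close> may be random (for instance, found by a line search that uses
  the current batch). The past at iteration \<open>k\<close> is therefore generated by all earlier batches
  and step sizes, which determine the iterate \<open>x\<^sub>k\<close>; independence from it means that a step
  size cannot anticipate later batches.
\<close>

definition past_events ::
  "'w measure \<Rightarrow> (nat \<Rightarrow> 'w \<Rightarrow> nat list) \<Rightarrow> (int \<Rightarrow> 'w \<Rightarrow> real) \<Rightarrow> nat \<Rightarrow> 'w set set" where
  "past_events M S \<gamma> k = sigma_sets (space M)
     ({S j -` X \<inter> space M | j X. j < k} \<union>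
      {\<gamma> j -` X \<inter> space M | j X. -1 \<le> j \<and> j < int k \<and> X \<in> sets borel})"

definition uniform_sampling ::
  "'w measure \<Rightarrow> nat \<Rightarrow> (nat \<Rightarrow> nat) \<Rightarrow> (nat \<Rightarrow> 'w \<Rightarrow> nat list) \<Rightarrow> (int \<Rightarrow> 'w \<Rightarrow> real) \<Rightarrow> bool" where
  "uniform_sampling M n b S \<gamma> \<longleftrightarrow>
     (\<forall>j\<ge>-1. \<gamma> j \<in> borel_measurable M) \<and>
     (\<forall>k. S k \<in> measurable M (count_space UNIV) \<and>
          distr M (count_space UNIV) (S k) =
            measure_pmf (replicate_pmf (b k) (pmf_of_set {1..n})) \<and>
          prob_space.indep_set M {S k -` X \<inter> space M | X. True} (past_events M S \<gamma> k))"

text \<open>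
  One trajectory of DecPolyakSEG, as a relation between the data and the generated sequences.
  Sequences starting at index \<open>-1\<close> are indexed by integers, and only their values from \<open>-1\<close> on
  matter. The values of \<open>\<alpha>\<close> are extended reals because \<open>\<alpha>\<^sub>-\<^sub>1 = \<infinity>\<close>; for \<open>k \<ge> 0\<close>, \<open>\<alpha>\<^sub>k\<close> is a
  minimum involving a finite number, so that \<open>real_of_ereal\<close> below loses nothing.
\<close>

definition dec_polyak_seg ::
  "(nat \<Rightarrow> 'a::real_inner \<Rightarrow> 'a) \<Rightarrow> (int \<Rightarrow> real) \<Rightarrow> 'a \<Rightarrow> (nat \<Rightarrow> nat list) \<Rightarrow> (int \<Rightarrow> real) \<Rightarrow>
   (nat \<Rightarrow> 'a) \<Rightarrow> (nat \<Rightarrow> 'a) \<Rightarrow> (int \<Rightarrow> ereal) \<Rightarrow> bool" where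
  "dec_polyak_seg F c x0 S \<gamma> x xhat \<alpha> \<longleftrightarrow>
     x 0 = x0 \<and> 0 < \<gamma> (-1) \<and> \<alpha> (-1) = \<infinity> \<and>
     (\<forall>k::nat.
        0 < \<gamma> (int k) \<and>
        \<gamma> (int k) \<le> c (int k - 1) / c (int k) * \<gamma> (int k - 1) \<and>
        xhat k = x k - \<gamma> (int k) *\<^sub>R batch_operator F (S k) (x k) \<and>
        \<alpha> (int k) =
          (let g = batch_operator F (S k) (xhat k) in
           min (if g = 0 then ereal (\<gamma> (int k))
                else ereal (inner g (x k - xhat k) / (norm g)\<^sup>2))
               (\<alpha> (int k - 1))) \<and>
        x (Suc k) =
          x k - real_of_ereal (\<alpha> (int k)) *\<^sub>R batch_operator F (S k) (xhat k))"

definition critical_condition ::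
  "(nat \<Rightarrow> 'a::real_normed_vector \<Rightarrow> 'a) \<Rightarrow> real \<Rightarrow> (nat \<Rightarrow> nat list) \<Rightarrow>
   (nat \<Rightarrow> 'a) \<Rightarrow> (nat \<Rightarrow> 'a) \<Rightarrow> bool" where
  "critical_condition F A S x xhat \<longleftrightarrow>
     (\<forall>k. norm (batch_operator F (S k) (xhat k) - batch_operator F (S k) (x k))
            \<le> A * norm (batch_operator F (S k) (x k)))"

end

theory Submission
  imports Defs
begin

text \<open>
  The bound holds on every trajectory whose batches are non-empty lists of indices from
  \<open>{1..n}\<close>, and almost every sample point yields such a trajectory,
  because the law of a batch is supported on these lists.

  Fix an iteration with batch operator \<open>G\<close>, iterate \<open>x\<close>, step size \<open>\<gamma>\<close>, \<open>h = G x\<close>,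
  \<open>y = x - \<gamma> h\<close> and \<open>g = G y\<close>, and let \<open>\<parallel>G x\<^sub>*\<parallel> \<le> \<sigma>\<close>. Strong monotonicity makes \<open>G\<close>
  expand distances by at least \<open>\<mu>\<close>, whereas the critical condition says that \<open>g\<close> differs from
  \<open>h\<close> by at most \<open>A \<parallel>h\<parallel>\<close>; as \<open>\<parallel>x - y\<parallel> = \<gamma> \<parallel>h\<parallel>\<close>, this forces \<open>\<mu> \<gamma> \<le> A\<close> (lemma
  \<open>critical_step_size_le\<close>) unless \<open>h = 0\<close>. If \<open>h = 0\<close>, then also \<open>g = 0\<close> by the critical
  condition, and whenever \<open>g = 0\<close> the iterate does not move. Otherwise, the Polyak rule \<open>\<alpha> \<parallel>g\<parallel>\<^sup>2 \<le> \<langle>g, x - y\<rangle>\<close> absorbs the quadratic term of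
  the update,
  \<open>\<parallel>x - \<alpha> g - x\<^sub>*\<parallel>\<^sup>2 \<le> \<parallel>x - x\<^sub>*\<parallel>\<^sup>2 - \<alpha> (\<langle>g, x - y\<rangle> + 2 \<langle>g, y - x\<^sub>*\<rangle>)\<close>,
  and the bracket is bounded from below by combining three estimates:
  \<open>\<langle>g, x - y\<rangle> \<ge> (1 - A) \<parallel>x - y\<parallel>\<^sup>2 / \<gamma>\<close> (critical condition),
  \<open>2 \<langle>g, y - x\<^sub>*\<rangle> \<ge> \<mu> \<parallel>y - x\<^sub>*\<parallel>\<^sup>2 - \<sigma>\<^sup>2 / \<mu>\<close> (strong monotonicity and Young's inequality), and a
  weighted triangle inequality that, thanks to \<open>\<mu> \<gamma> \<le> A\<close>, merges the two squares into
  \<open>\<mu> (1 - A) \<parallel>x - x\<^sub>*\<parallel>\<^sup>2\<close>. With \<open>t = \<alpha> \<mu> (1 - A)\<close> this reads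
  \<open>\<parallel>x - \<alpha> g - x\<^sub>*\<parallel>\<^sup>2 \<le> (1 - t) \<parallel>x - x\<^sub>*\<parallel>\<^sup>2 + t (\<sigma>\<^sup>2 / (\<mu>\<^sup>2 (1 - A)))\<close>,
  and \<open>0 \<le> t \<le> 1\<close>, so the new squared distance is at most a convex combination of the old one
  and a constant (lemma \<open>polyak_step_convex_combination\<close>). By induction it never exceeds the
  larger of its initial value and that constant. Since \<open>\<parallel>x - y\<parallel> = \<gamma> \<parallel>h\<parallel> \<le> A \<parallel>h\<parallel> / \<mu>\<close>, the
  Lipschitz bound on \<open>h\<close> then confines the extrapolated points.
\<close>

section \<open>Mini-batch averages\<close>

lemma batch_operator_diff:
  "batch_operator F S x - batch_operator F S y =
     batch_operator (\<lambda>i _. F i x - F i y) S x"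
  by (simp add: batch_operator_def sum_list_subtractf scaleR_diff_right)

lemma inner_sum_list_left: "inner (\<Sum>i\<leftarrow>S. f i) v = (\<Sum>i\<leftarrow>S. inner (f i) v)"
  by (induction S) (simp_all add: inner_add_left)

lemma length_times_le_sum_list:
  fixes f :: "'b \<Rightarrow> real"
  assumes "\<And>i. i \<in> set S \<Longrightarrow> K \<le> f i"
  shows "real (length S) * K \<le> (\<Sum>i\<leftarrow>S. f i)"
  using sum_list_mono[of S "\<lambda>_. K" f] assms by (simp add: sum_list_triv)

lemma norm_batch_operator_le:
  fixes F :: "nat \<Rightarrow> 'a::real_normed_vector \<Rightarrow> 'a"
  assumes "S \<noteq> []" and "\<And>i. i \<in> set S \<Longrightarrow> norm (F i x) \<le> K"
  shows "norm (batch_operator F S x) \<le> K"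
proof -
  have "norm (\<Sum>i\<leftarrow>S. F i x) \<le> real (length S) * K"
    using assms(2)
  proof (induction S)
    case (Cons a S)
    then have "norm (F a x) \<le> K" "norm (\<Sum>i\<leftarrow>S. F i x) \<le> real (length S) * K"
      by auto
    then show ?case
      using norm_triangle_ineq[of "F a x" "\<Sum>i\<leftarrow>S. F i x"] by (simp add: algebra_simps)
  qed simp
  then show ?thesis
    using assms(1) by (simp add: batch_operator_def field_simps)
qed

lemma strongly_monotone_batch_operator:
  assumes "S \<noteq> []" and "\<And>i. i \<in> set S \<Longrightarrow> strongly_monotone \<mu> (F i)"
  shows "strongly_monotone \<mu> (batch_operator F S)"
  unfolding strongly_monotone_def
proof (intro allI)
  fix x y
  have "real (length S) * (\<mu> * (norm (x - y))\<^sup>2) \<le> (\<Sum>i\<leftarrow>S. inner (F i x - F i y) (x - y))"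
    using assms(2) by (intro length_times_le_sum_list) (auto simp: strongly_monotone_def)
  then show "\<mu> * (norm (x - y))\<^sup>2 \<le> inner (batch_operator F S x - batch_operator F S y) (x - y)"
    unfolding batch_operator_diff using assms(1)
    by (simp add: batch_operator_def inner_sum_list_left field_simps)
qed

lemma lipschitz_on_batch_operator:
  fixes F :: "nat \<Rightarrow> 'a::real_normed_vector \<Rightarrow> 'a"
  assumes "S \<noteq> []" and "\<And>i. i \<in> set S \<Longrightarrow> L-lipschitz_on UNIV (F i)"
  shows "L-lipschitz_on UNIV (batch_operator F S)"
proof (rule lipschitz_onI)
  show "dist (batch_operator F S x) (batch_operator F S y) \<le> L * dist x y" for x y
    unfolding dist_norm batch_operator_diff
  proof (rule norm_batch_operator_le[OF assms(1)])
    show "norm (F i x - F i y) \<le> L * norm (x - y)" if "i \<in> set S" for i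
      using lipschitz_onD[OF assms(2)[OF that], of x y] by (simp add: dist_norm)
  qed
  show "0 \<le> L"
    using assms by (meson last_in_set lipschitz_on_nonneg)
qed

section \<open>One step of the method\<close>

lemma strongly_monotone_expansion:
  assumes "strongly_monotone \<mu> G"
  shows "\<mu> * norm (x - y) \<le> norm (G x - G y)"
proof (cases "x = y")
  case False
  have "\<mu> * (norm (x - y))\<^sup>2 \<le> norm (G x - G y) * norm (x - y)"
    using assms norm_cauchy_schwarz[of "G x - G y" "x - y"]
    unfolding strongly_monotone_def by (meson order_trans)
  with False show ?thesis
    by (simp add: power2_eq_square)
qed simp

text \<open>
  The critical condition is an upper bound on how much \<open>G\<close> changes along the extrapolation,
  strong monotonicity a lower one; comparing them bounds the step size.
\<close>

lemma critical_step_size_le: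
  assumes "strongly_monotone \<mu> G" and "0 < \<gamma>" and "G x \<noteq> 0"
    and "norm (G (x - \<gamma> *\<^sub>R G x) - G x) \<le> A * norm (G x)"
  shows "\<mu> * \<gamma> \<le> A"
proof -
  have "\<mu> * (\<gamma> * norm (G x)) \<le> norm (G (x - \<gamma> *\<^sub>R G x) - G x)"
    using strongly_monotone_expansion[OF assms(1), of "x - \<gamma> *\<^sub>R G x" x] assms(2) by simp
  with assms(4) have "(\<mu> * \<gamma>) * norm (G x) \<le> A * norm (G x)"
    by (simp add: mult.assoc)
  with assms(3) show ?thesis
    by simp
qed

lemma inner_ge_of_relative_error:
  fixes g h :: "'a::real_inner"
  assumes "norm (g - h) \<le> A * norm h"
  shows "(1 - A) * (norm h)\<^sup>2 \<le> inner g h"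
proof -
  have "- inner (g - h) h \<le> norm (g - h) * norm h"
    using norm_cauchy_schwarz[of "- (g - h)" h] by (simp add: norm_minus_commute inner_diff_left)
  also have "\<dots> \<le> A * norm h * norm h"
    using assms by (rule mult_right_mono) simp
  finally show ?thesis
    by (simp add: inner_diff_left power2_norm_eq_inner[symmetric] algebra_simps power2_eq_square)
qed

text \<open>
  The inequality that produces the factor \<open>1 - A\<close> in the final bound: after multiplication by
  \<open>A\<close>, the two sides differ by the square of \<open>(1 - A) p - A q\<close>.
\<close>

lemma weighted_square_sum_ge:
  fixes p q A :: real
  assumes "0 < A"
  shows "(1 - A) * (p + q)\<^sup>2 \<le> (1 - A) / A * p\<^sup>2 + q\<^sup>2"
proof -
  have "0 \<le> ((1 - A) * p - A * q)\<^sup>2"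
    by simp
  then have "A * ((1 - A) * (p + q)\<^sup>2) \<le> (1 - A) * p\<^sup>2 + A * q\<^sup>2"
    by (simp add: power2_eq_square algebra_simps)
  with assms show ?thesis
    by (simp add: field_simps)
qed

lemma strongly_monotone_inner_ge:
  assumes "strongly_monotone \<mu> G" and "0 < \<mu>" and "norm (G z) \<le> \<sigma>"
  shows "\<mu> * (norm (y - z))\<^sup>2 - \<sigma>\<^sup>2 / \<mu> \<le> 2 * inner (G y) (y - z)"
proof -
  define q where "q = norm (y - z)"
  have "\<mu> * q\<^sup>2 \<le> inner (G y) (y - z) - inner (G z) (y - z)"
    using assms(1) by (simp add: strongly_monotone_def q_def inner_diff_left)
  moreover have "- inner (G z) (y - z) \<le> norm (G z) * q"
    using norm_cauchy_schwarz[of "- G z" "y - z"] by (simp add: q_def)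
  moreover have "norm (G z) * q \<le> \<sigma> * q"
    using assms(3) by (intro mult_right_mono) (simp_all add: q_def)
  moreover have "2 * (\<sigma> * q) \<le> \<mu> * q\<^sup>2 + \<sigma>\<^sup>2 / \<mu>"
  proof -
    have "0 \<le> (\<mu> * q - \<sigma>)\<^sup>2"
      by simp
    with assms(2) show ?thesis
      by (simp add: field_simps power2_eq_square)
  qed
  ultimately show ?thesis
    unfolding q_def by linarith
qed

text \<open>
  With \<open>g = G y\<close> and \<open>h = G x\<close>, the Polyak rule enters twice: it absorbs the term
  \<open>\<alpha>\<^sup>2 \<parallel>g\<parallel>\<^sup>2\<close> of the expanded square, and together with \<open>\<parallel>g\<parallel> \<ge> (1 - A) \<parallel>h\<parallel>\<close> and
  \<open>\<mu> \<gamma> \<le> A\<close> it keeps the weight \<open>t = \<alpha> \<mu> (1 - A)\<close> at most \<open>1\<close>.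
  Without the latter a step could overshoot, and a bound on the distance would not persist.
\<close>

lemma polyak_step_convex_combination:
  fixes G :: "'a::real_inner \<Rightarrow> 'a"
  assumes sm: "strongly_monotone \<mu> G" and mu: "0 < \<mu>" and A: "0 < A" "A < 1"
    and gamma: "0 < \<gamma>" and y: "y = x - \<gamma> *\<^sub>R G x"
    and crit: "norm (G y - G x) \<le> A * norm (G x)"
    and nz: "G y \<noteq> 0"
    and alpha: "0 \<le> \<alpha>" "\<alpha> \<le> inner (G y) (x - y) / (norm (G y))\<^sup>2"
    and sigma: "norm (G z) \<le> \<sigma>"
  obtains t where "0 \<le> t" "t \<le> 1"
    "(norm (x - \<alpha> *\<^sub>R G y - z))\<^sup>2
       \<le> (1 - t) * (norm (x - z))\<^sup>2 + t * (\<sigma>\<^sup>2 / (\<mu>\<^sup>2 * (1 - A)))"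
proof
  define g where "g = G y"
  define h where "h = G x"
  define p where "p = norm (x - y)"
  define q where "q = norm (y - z)"
  define t where "t = \<alpha> * \<mu> * (1 - A)"
  have p: "p = \<gamma> * norm h"
    using gamma by (simp add: p_def h_def y)
  have h0: "h \<noteq> 0"
    using crit nz by (auto simp: h_def)
  have g0: "norm g > 0"
    using nz by (simp add: g_def)
  have step: "\<mu> * \<gamma> \<le> A"
    using critical_step_size_le[OF sm gamma] crit h0 by (simp add: h_def y)
  have polyak: "\<alpha> * (norm g)\<^sup>2 \<le> inner g (x - y)"
    using alpha(2) g0 by (simp add: g_def field_simps)
  show "0 \<le> \<alpha> * \<mu> * (1 - A)"
    using alpha(1) mu A by simp
  have "(1 - A) * norm h \<le> norm g"
    using crit norm_triangle_ineq2[of h g]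
    by (simp add: g_def h_def norm_minus_commute algebra_simps)
  moreover have "\<alpha> * norm g \<le> p"
  proof -
    have "\<alpha> * norm g * norm g \<le> p * norm g"
      using polyak norm_cauchy_schwarz[of g "x - y"]
      by (simp add: p_def power2_eq_square algebra_simps)
    with g0 show ?thesis by simp
  qed
  ultimately have "\<alpha> * ((1 - A) * norm h) \<le> \<gamma> * norm h"
    using mult_left_mono[OF _ alpha(1)] p by (meson order_trans)
  then have "\<alpha> * (1 - A) \<le> \<gamma>"
    using h0 by (simp flip: mult.assoc)
  then have "\<mu> * (\<alpha> * (1 - A)) \<le> \<mu> * \<gamma>"
    using mu by simp
  with step A(2) show "\<alpha> * \<mu> * (1 - A) \<le> 1"
    by (simp add: ac_simps)
  have bracket: "\<mu> * (1 - A) * (norm (x - z))\<^sup>2 - \<sigma>\<^sup>2 / \<mu>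
      \<le> inner g (x - y) + 2 * inner g (y - z)"
  proof -
    have "norm (x - z) \<le> p + q"
      using norm_triangle_ineq[of "x - y" "y - z"] by (simp add: p_def q_def)
    then have "(norm (x - z))\<^sup>2 \<le> (p + q)\<^sup>2"
      by (intro power_mono) simp_all
    then have "(1 - A) * (norm (x - z))\<^sup>2 \<le> (1 - A) * (p + q)\<^sup>2"
      using A(2) by simp
    also have "\<dots> \<le> (1 - A) / A * p\<^sup>2 + q\<^sup>2"
      by (rule weighted_square_sum_ge[OF A(1)])
    finally have "\<mu> * ((1 - A) * (norm (x - z))\<^sup>2) \<le> \<mu> * ((1 - A) / A * p\<^sup>2 + q\<^sup>2)"
      using mu by simp
    moreover have "\<mu> * ((1 - A) / A * p\<^sup>2) \<le> inner g (x - y)"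
    proof -
      have "\<mu> * ((1 - A) / A * p\<^sup>2) = (\<mu> * \<gamma>) * (\<gamma> * (1 - A) * (norm h)\<^sup>2 / A)"
        by (simp add: p power2_eq_square)
      also have "\<dots> \<le> A * (\<gamma> * (1 - A) * (norm h)\<^sup>2 / A)"
        using step A gamma by (intro mult_right_mono) simp_all
      also have "\<dots> = \<gamma> * ((1 - A) * (norm h)\<^sup>2)"
        using A by simp
      also have "\<dots> \<le> \<gamma> * inner g h"
        using inner_ge_of_relative_error[of g h A] crit gamma
        by (simp add: g_def h_def)
      also have "\<dots> = inner g (x - y)"
        by (simp add: y h_def)
      finally show ?thesis .
    qed
    moreover have "\<mu> * q\<^sup>2 - \<sigma>\<^sup>2 / \<mu> \<le> 2 * inner g (y - z)"
      unfolding g_def q_def by (rule strongly_monotone_inner_ge[OF sm mu sigma])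
    ultimately show ?thesis
      by (simp add: algebra_simps)
  qed
  have "(norm (x - \<alpha> *\<^sub>R g - z))\<^sup>2
      = (norm (x - z))\<^sup>2 - 2 * \<alpha> * inner g (x - z) + \<alpha> * (\<alpha> * (norm g)\<^sup>2)"
    by (simp add: power2_norm_eq_inner inner_diff_left inner_diff_right inner_commute
        algebra_simps)
  also have "\<dots> \<le> (norm (x - z))\<^sup>2 - 2 * \<alpha> * inner g (x - z) + \<alpha> * inner g (x - y)"
    using mult_left_mono[OF polyak alpha(1)] by simp
  also have "\<dots> = (norm (x - z))\<^sup>2 - \<alpha> * (inner g (x - y) + 2 * inner g (y - z))"
    by (simp add: inner_diff_right algebra_simps)
  also have "\<dots> \<le> (norm (x - z))\<^sup>2 - \<alpha> * (\<mu> * (1 - A) * (norm (x - z))\<^sup>2 - \<sigma>\<^sup>2 / \<mu>)"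
    using mult_left_mono[OF bracket alpha(1)] by simp
  also have "\<dots> = (1 - t) * (norm (x - z))\<^sup>2 + t * (\<sigma>\<^sup>2 / (\<mu>\<^sup>2 * (1 - A)))"
    using mu A by (simp add: t_def field_simps power2_eq_square)
  finally show "(norm (x - \<alpha> *\<^sub>R G y - z))\<^sup>2
       \<le> (1 - \<alpha> * \<mu> * (1 - A)) * (norm (x - z))\<^sup>2
          + \<alpha> * \<mu> * (1 - A) * (\<sigma>\<^sup>2 / (\<mu>\<^sup>2 * (1 - A)))"
    by (simp add: g_def t_def)
qed

section \<open>Trajectories\<close>

text \<open>
  Here \<open>h\<close> and \<open>g\<close> are the values of the \<open>k\<close>-th batch operator at \<open>x\<^sub>k\<close> and at the extrapolated
  point. The numerator of the Polyak ratio is \<open>\<gamma>\<^sub>k \<langle>g, h\<rangle>\<close>, which the critical condition makes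
  positive when \<open>g \<noteq> 0\<close>; so every candidate in the running minimum is positive, starting from
  \<open>\<alpha>\<^sub>-\<^sub>1 = \<infinity>\<close>.
\<close>

lemma dec_polyak_seg_alpha_pos:
  assumes seg: "dec_polyak_seg F c x0 S \<gamma> x xhat \<alpha>"
    and crit: "critical_condition F A S x xhat" and A: "A < 1"
  shows "0 < \<alpha> (int k)"
proof -
  \<comment> \<open>Shifting the index by one makes the start \<open>\<alpha>\<^sub>-\<^sub>1\<close> the base case.\<close>
  have "0 < \<alpha> (int m - 1)" for m
  proof (induction m)
    case 0
    show ?case
      using seg by (simp add: dec_polyak_seg_def)
  next
    case (Suc m)
    define g where "g = batch_operator F (S m) (xhat m)"
    define h where "h = batch_operator F (S m) (x m)"
    have gamma: "0 < \<gamma> (int m)" and xhat: "xhat m = x m - \<gamma> (int m) *\<^sub>R h"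
      and alpha: "\<alpha> (int m) = min (if g = 0 then ereal (\<gamma> (int m))
                else ereal (inner g (x m - xhat m) / (norm g)\<^sup>2)) (\<alpha> (int m - 1))"
      using seg by (simp_all add: dec_polyak_seg_def Let_def g_def h_def)
    have c: "norm (g - h) \<le> A * norm h"
      using crit by (simp add: critical_condition_def g_def h_def)
    have "0 < inner g (x m - xhat m)" if "g \<noteq> 0"
    proof -
      have "h \<noteq> 0"
        using c that by auto
      with A have "0 < (1 - A) * (norm h)\<^sup>2"
        by simp
      with inner_ge_of_relative_error[OF c] gamma show ?thesis
        by (simp add: xhat)
    qed
    with Suc gamma show ?case
      by (simp add: alpha)
  qed
  from this[of "Suc k"] show ?thesis
    by simp
qed

lemma dec_polyak_seg_dist_le:
  fixes F :: "nat \<Rightarrow> 'a::real_inner \<Rightarrow> 'a"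
  assumes seg: "dec_polyak_seg F c x0 S \<gamma> x xhat \<alpha>"
    and crit: "critical_condition F A S x xhat"
    and sm: "\<And>k. strongly_monotone \<mu> (batch_operator F (S k))" and mu: "0 < \<mu>"
    and sigma: "\<And>k. norm (batch_operator F (S k) z) \<le> \<sigma>"
    and A: "0 < A" "A < 1"
  shows "(norm (x k - z))\<^sup>2 \<le> max ((norm (x0 - z))\<^sup>2) (\<sigma>\<^sup>2 / (\<mu>\<^sup>2 * (1 - A)))" (is "_ \<le> ?R")
proof (induction k)
  case 0
  show ?case
    using seg by (simp add: dec_polyak_seg_def)
next
  case (Suc k)
  define G where "G = batch_operator F (S k)"
  define a where "a = real_of_ereal (\<alpha> (int k))"
  have gamma: "0 < \<gamma> (int k)" and xhat: "xhat k = x k - \<gamma> (int k) *\<^sub>R G (x k)"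
    and next_x: "x (Suc k) = x k - a *\<^sub>R G (xhat k)"
    and alpha: "\<alpha> (int k) = min (if G (xhat k) = 0 then ereal (\<gamma> (int k))
          else ereal (inner (G (xhat k)) (x k - xhat k) / (norm (G (xhat k)))\<^sup>2)) (\<alpha> (int k - 1))"
    using seg by (simp_all add: dec_polyak_seg_def Let_def G_def a_def)
  have alpha_pos: "0 < \<alpha> (int k)"
    by (rule dec_polyak_seg_alpha_pos[OF seg crit A(2)])
  show ?case
  proof (cases "G (xhat k) = 0")
    case True
    with Suc next_x show ?thesis
      by simp
  next
    case False
    have alpha_le: "\<alpha> (int k) \<le> ereal (inner (G (xhat k)) (x k - xhat k) / (norm (G (xhat k)))\<^sup>2)"
      using alpha False by simp
    have a: "0 \<le> a" "a \<le> inner (G (xhat k)) (x k - xhat k) / (norm (G (xhat k)))\<^sup>2"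
      using alpha_pos alpha_le unfolding a_def by (cases "\<alpha> (int k)"; simp)+
    have "norm (G (xhat k) - G (x k)) \<le> A * norm (G (x k))"
      using crit by (simp add: critical_condition_def G_def)
    then obtain t where t: "0 \<le> t" "t \<le> 1"
      "(norm (x (Suc k) - z))\<^sup>2
         \<le> (1 - t) * (norm (x k - z))\<^sup>2 + t * (\<sigma>\<^sup>2 / (\<mu>\<^sup>2 * (1 - A)))"
      using polyak_step_convex_combination[OF sm[of k, folded G_def] mu A gamma xhat _ False a
          sigma[of k, folded G_def]] next_x
      by metis
    have "(1 - t) * (norm (x k - z))\<^sup>2 + t * (\<sigma>\<^sup>2 / (\<mu>\<^sup>2 * (1 - A))) \<le> (1 - t) * ?R + t * ?R"
      using Suc t by (intro add_mono mult_left_mono) simp_all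
    also have "\<dots> = ?R"
      by (simp add: algebra_simps)
    finally show ?thesis
      using t(3) by linarith
  qed
qed

lemma dec_polyak_seg_extrapolation_le:
  assumes seg: "dec_polyak_seg F c x0 S \<gamma> x xhat \<alpha>"
    and crit: "critical_condition F A S x xhat"
    and sm: "strongly_monotone \<mu> (batch_operator F (S k))" and mu: "0 < \<mu>"
  shows "norm (x k - xhat k) \<le> A / \<mu> * norm (batch_operator F (S k) (x k))"
proof -
  define h where "h = batch_operator F (S k) (x k)"
  have gamma: "0 < \<gamma> (int k)" and xhat: "xhat k = x k - \<gamma> (int k) *\<^sub>R h"
    using seg by (simp_all add: dec_polyak_seg_def h_def)
  show ?thesis
  proof (cases "h = 0")
    case True
    then show ?thesis
      by (simp add: xhat h_def[symmetric])
  next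
    case False
    have "\<mu> * \<gamma> (int k) \<le> A"
      using critical_step_size_le[OF sm gamma, of "x k" A] crit False xhat
      by (metis critical_condition_def h_def)
    then have "\<gamma> (int k) \<le> A / \<mu>"
      using mu by (simp add: field_simps)
    then have "\<gamma> (int k) * norm h \<le> A / \<mu> * norm h"
      by (rule mult_right_mono) simp
    with gamma show ?thesis
      by (simp add: xhat h_def[symmetric])
  qed
qed

section \<open>Almost sure boundedness\<close>

lemma uniform_sampling_AE_batch:
  assumes "n \<ge> 1" and "uniform_sampling M n b S \<gamma>"
  shows "AE \<omega> in M. \<forall>k. length (S k \<omega>) = b k \<and> set (S k \<omega>) \<subseteq> {1..n}"
  unfolding AE_all_countable
proof
  fix k
  define p where "p = replicate_pmf (b k) (pmf_of_set {1..n})"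
  have meas: "S k \<in> measurable M (count_space UNIV)"
    and distr: "distr M (count_space UNIV) (S k) = measure_pmf p"
    using assms(2) by (simp_all add: uniform_sampling_def p_def)
  have "AE l in distr M (count_space UNIV) (S k). l \<in> set_pmf p"
    unfolding distr by (rule AE_measure_pmf)
  then have "AE \<omega> in M. S k \<omega> \<in> set_pmf p"
    using meas by (subst (asm) AE_distr_iff) simp_all
  moreover have "set_pmf p = {l \<in> lists {1..n}. length l = b k}"
    using assms(1) by (simp add: p_def set_replicate_pmf set_pmf_of_set)
  ultimately show "AE \<omega> in M. length (S k \<omega>) = b k \<and> set (S k \<omega>) \<subseteq> {1..n}"
    by (auto simp: in_lists_conv_set subset_iff)
qed

theorem proposition4p8:
  fixes M :: "'w measure"
    and n :: nat
    and F :: "nat \<Rightarrow> real ^ 'd \<Rightarrow> real ^ 'd"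
    and L \<mu> A :: real
    and xs x0 :: "real ^ 'd"
    and b :: "nat \<Rightarrow> nat"
    and S :: "nat \<Rightarrow> 'w \<Rightarrow> nat list"
    and c :: "int \<Rightarrow> real"
    and \<gamma> :: "int \<Rightarrow> 'w \<Rightarrow> real"
    and \<alpha> :: "int \<Rightarrow> 'w \<Rightarrow> ereal"
    and x xhat :: "nat \<Rightarrow> 'w \<Rightarrow> real ^ 'd"
  assumes "prob_space M"
    and "n \<ge> 1"
    and "\<And>i. i \<in> {1..n} \<Longrightarrow> L-lipschitz_on UNIV (F i)"
    and "\<mu> > 0"
    and "\<And>i. i \<in> {1..n} \<Longrightarrow> strongly_monotone \<mu> (F i)"
    and "full_operator n F xs = 0"
    and "\<And>k. b k \<ge> 1"
    and "uniform_sampling M n b S \<gamma>"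
    and "mono_on {-1..} c"
    and "\<And>k. k \<ge> -1 \<Longrightarrow> c k > 0"
    and "AE \<omega> in M. dec_polyak_seg F c x0 (\<lambda>k. S k \<omega>) (\<lambda>k. \<gamma> k \<omega>)
           (\<lambda>k. x k \<omega>) (\<lambda>k. xhat k \<omega>) (\<lambda>k. \<alpha> k \<omega>)"
    and "0 < A" and "A < 1"
    and "AE \<omega> in M. critical_condition F A (\<lambda>k. S k \<omega>) (\<lambda>k. x k \<omega>) (\<lambda>k. xhat k \<omega>)"
  shows "(AE \<omega> in M.
            (SUP k. ereal ((norm (x k \<omega> - xs))\<^sup>2))
              \<le> ereal (max ((norm (x0 - xs))\<^sup>2)
                    (1 / (\<mu>\<^sup>2 * (1 - A)) * (MAX i\<in>{1..n}. (norm (F i xs))\<^sup>2))) \<and>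
            (SUP k. ereal ((norm (x k \<omega> - xs))\<^sup>2)) < \<infinity>) \<and>
         (AE \<omega> in M. bounded (range (\<lambda>k. xhat k \<omega>)))"
proof -
  define B where "B = (MAX i\<in>{1..n}. (norm (F i xs))\<^sup>2)"
  define R where "R = max ((norm (x0 - xs))\<^sup>2) (1 / (\<mu>\<^sup>2 * (1 - A)) * B)"
  have B: "(norm (F i xs))\<^sup>2 \<le> B" if "i \<in> {1..n}" for i
    unfolding B_def using that by (intro Max_ge) auto
  have B0: "0 \<le> B"
    using B[of 1] assms(2) zero_le_power2[of "norm (F 1 xs)"]
    by (meson atLeastAtMost_iff order_refl order_trans)
  have trajectory: "(\<forall>k. (norm (x k \<omega> - xs))\<^sup>2 \<le> R) \<and> bounded (range (\<lambda>k. xhat k \<omega>))"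
    if seg: "dec_polyak_seg F c x0 (\<lambda>k. S k \<omega>) (\<lambda>k. \<gamma> k \<omega>)
           (\<lambda>k. x k \<omega>) (\<lambda>k. xhat k \<omega>) (\<lambda>k. \<alpha> k \<omega>)"
      and crit: "critical_condition F A (\<lambda>k. S k \<omega>) (\<lambda>k. x k \<omega>) (\<lambda>k. xhat k \<omega>)"
      and batch: "\<forall>k. length (S k \<omega>) = b k \<and> set (S k \<omega>) \<subseteq> {1..n}" for \<omega>
  proof -
    have nonempty: "S k \<omega> \<noteq> []" for k
      using batch assms(7)[of k] by (metis list.size(3) not_one_le_zero)
    have index: "i \<in> {1..n}" if "i \<in> set (S k \<omega>)" for i k
      using batch that by blast
    have sm: "strongly_monotone \<mu> (batch_operator F (S k \<omega>))" for k
      using nonempty assms(5) index by (intro strongly_monotone_batch_operator) blast+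
    have lip: "L-lipschitz_on UNIV (batch_operator F (S k \<omega>))" for k
      using nonempty assms(3) index by (intro lipschitz_on_batch_operator) blast+
    have sigma: "norm (batch_operator F (S k \<omega>) xs) \<le> sqrt B" for k
      using nonempty B index by (intro norm_batch_operator_le real_le_rsqrt) blast+
    have dist: "(norm (x k \<omega> - xs))\<^sup>2 \<le> R" for k
      using dec_polyak_seg_dist_le[OF seg crit sm assms(4) sigma assms(12,13), of k] B0
      by (simp add: R_def)
    have "norm (xhat k \<omega>) \<le> norm xs + sqrt R + A / \<mu> * (sqrt B + L * sqrt R)" for k
    proof -
      let ?G = "batch_operator F (S k \<omega>)"
      have r: "norm (x k \<omega> - xs) \<le> sqrt R"
        using dist by (rule real_le_rsqrt)
      have "norm (?G (x k \<omega>) - ?G xs) \<le> L * norm (x k \<omega> - xs)"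
        using lipschitz_onD[OF lip, of "x k \<omega>" xs] by (simp add: dist_norm)
      also have "\<dots> \<le> L * sqrt R"
        using r lipschitz_on_nonneg[OF lip] by (rule mult_left_mono)
      finally have "norm (?G (x k \<omega>)) \<le> sqrt B + L * sqrt R"
        using sigma[of k] norm_triangle_sub[of "?G (x k \<omega>)" "?G xs"] by linarith
      then have "A / \<mu> * norm (?G (x k \<omega>)) \<le> A / \<mu> * (sqrt B + L * sqrt R)"
        using assms(4,12) by (intro mult_left_mono) simp_all
      moreover have "norm (x k \<omega> - xhat k \<omega>) \<le> A / \<mu> * norm (?G (x k \<omega>))"
        by (rule dec_polyak_seg_extrapolation_le[OF seg crit sm assms(4)])
      ultimately show ?thesis
        using r norm_triangle_sub[of "xhat k \<omega>" "x k \<omega>"] norm_triangle_sub[of "x k \<omega>" xs]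
        by (simp add: norm_minus_commute)
    qed
    then have "bounded (range (\<lambda>k. xhat k \<omega>))"
      by (intro boundedI) auto
    with dist show ?thesis
      by blast
  qed
  have AE: "AE \<omega> in M. (\<forall>k. (norm (x k \<omega> - xs))\<^sup>2 \<le> R) \<and> bounded (range (\<lambda>k. xhat k \<omega>))"
    using assms(11,14) uniform_sampling_AE_batch[OF assms(2,8)]
    by eventually_elim (rule trajectory)
  have sup: "(SUP k. ereal ((norm (x k \<omega> - xs))\<^sup>2)) \<le> ereal R \<and>
      (SUP k. ereal ((norm (x k \<omega> - xs))\<^sup>2)) < \<infinity>"
    if "\<forall>k. (norm (x k \<omega> - xs))\<^sup>2 \<le> R" for \<omega>
  proof -
    have "(SUP k. ereal ((norm (x k \<omega> - xs))\<^sup>2)) \<le> ereal R"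
      using that by (intro SUP_least) simp
    then show ?thesis
      by (auto intro: le_less_trans)
  qed
  show ?thesis
    unfolding B_def[symmetric] R_def[symmetric]
    using AE by (auto elim!: eventually_mono dest: sup)
qed

end
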